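(* Let $S_n=(S_n^x,S_n^y)$, $n\ge 0$, be the simple random walk on the 2-dimensional comb $\mathbf C_2$ started at $S_0=(0,0)$, and let $D_n^y=\max\{|S_i^y|:0\le i\le n\}$. Then $$\mathbb E[D_n^y]\sim\sqrt{\frac{\pi}{2}}\,n^{1/2}\qquad (n\to\infty).$$
   Context: The 2-dimensional comb $\mathbf C_2$ is the graph with vertex set $\mathbb Z^2$ obtained from the usual square lattice by removing all horizontal edges off the $x$-axis: $(x,y)$ is adjacent to $(x,y\pm1)$ for all $x,y\in\mathbb Z$, and $(x,0)$ is adjacent to $(x\pm1,0)$ for all $x\in\mathbb Z$. The simple random walk moves at each step to a uniformly chosen neighbour of the current vertex (transition probabilities $1/4$ from vertices on the $x$-axis and $1/2$ from other vertices). $a_n\sim b_n$ means $a_n/b_n\to1$. *)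

theory Defs
  imports "HOL-Probability.Probability" "HOL-Library.Landau_Symbols"
begin

definition comb2_adj :: "int \<times> int \<Rightarrow> int \<times> int \<Rightarrow> bool" where
  "comb2_adj v w \<longleftrightarrow>
     (fst w = fst v \<and> (snd w = snd v + 1 \<or> snd w = snd v - 1)) \<or>
     (snd v = 0 \<and> snd w = 0 \<and> (fst w = fst v + 1 \<or> fst w = fst v - 1))"

definition neighbours :: "('v \<Rightarrow> 'v \<Rightarrow> bool) \<Rightarrow> 'v \<Rightarrow> 'v set" where
  "neighbours adj v = {w. adj v w}"

text \<open>
  Simple random walk on the (locally finite) graph with adjacency relation \<open>adj\<close>, started at \<open>v0\<close>,
  as a process on an arbitrary probability space: conditionally on any history of positive
  probability, the next position is uniform on the neighbours of the current vertex.
  The measure \<^term>\<open>pmf_of_set A\<close> is unspecified unless \<open>A\<close> is finite and nonempty; for the comb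
  this is guaranteed by \<open>comb2_neighbours_finite\<close> and \<open>comb2_neighbours_nonempty\<close> below.
\<close>

definition simple_random_walk ::
  "('v \<Rightarrow> 'v \<Rightarrow> bool) \<Rightarrow> 'v \<Rightarrow> 'w measure \<Rightarrow> (nat \<Rightarrow> 'w \<Rightarrow> 'v) \<Rightarrow> bool" where
  "simple_random_walk adj v0 M S \<longleftrightarrow>
     prob_space M \<and>
     (\<forall>n. S n \<in> measurable M (count_space UNIV)) \<and>
     (AE \<omega> in M. S 0 \<omega> = v0) \<and>
     (\<forall>n (v :: nat \<Rightarrow> 'v) w.
        \<P>(\<omega> in M. \<forall>i\<le>n. S i \<omega> = v i) > 0 \<longrightarrow>
        \<P>(\<omega> in M. S (Suc n) \<omega> = w \<bar> \<forall>i\<le>n. S i \<omega> = v i) =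
          pmf (pmf_of_set (neighbours adj (v n))) w)"

definition max_height :: "(nat \<Rightarrow> 'w \<Rightarrow> int \<times> int) \<Rightarrow> nat \<Rightarrow> 'w \<Rightarrow> int" where
  "max_height S n \<omega> = Max ((\<lambda>i. \<bar>snd (S i \<omega>)\<bar>) ` {0..n})"

lemma comb2_neighbours_axis:
  "neighbours comb2_adj (x, 0) = {(x, 1), (x, -1), (x + 1, 0), (x - 1, 0)}"
  by (auto simp: neighbours_def comb2_adj_def)

lemma comb2_neighbours_off_axis:
  "y \<noteq> 0 \<Longrightarrow> neighbours comb2_adj (x, y) = {(x, y + 1), (x, y - 1)}"
  by (auto simp: neighbours_def comb2_adj_def)

lemma comb2_neighbours_finite: "finite (neighbours comb2_adj v)"
  by (cases v; cases "snd v = 0") (simp_all add: comb2_neighbours_axis comb2_neighbours_off_axis)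

lemma comb2_neighbours_nonempty: "neighbours comb2_adj v \<noteq> {}"
  by (cases v; cases "snd v = 0") (simp_all add: comb2_neighbours_axis comb2_neighbours_off_axis)

lemma comb2_step_axis:
  "comb2_adj (x, 0) w \<Longrightarrow> pmf (pmf_of_set (neighbours comb2_adj (x, 0))) w = 1 / 4"
  using comb2_neighbours_finite[of "(x, 0)"] comb2_neighbours_nonempty[of "(x, 0)"]
  by (simp add: pmf_of_set neighbours_def[of comb2_adj "(x, 0)", symmetric] comb2_neighbours_axis)
     (auto simp: indicator_def comb2_adj_def prod_eq_iff)

lemma comb2_step_off_axis:
  "y \<noteq> 0 \<Longrightarrow> comb2_adj (x, y) w \<Longrightarrow> pmf (pmf_of_set (neighbours comb2_adj (x, y))) w = 1 / 2"
  using comb2_neighbours_finite[of "(x, y)"] comb2_neighbours_nonempty[of "(x, y)"]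
  by (simp add: pmf_of_set comb2_neighbours_off_axis)
     (auto simp: indicator_def comb2_adj_def prod_eq_iff)

end

theory Submission
  imports Defs "HOL-Real_Asymp.Real_Asymp"
begin

text \<open>
  The distance \<open>\<bar>S\<^sup>y\<bar>\<close> from the axis is itself a Markov chain: away from \<open>0\<close> it moves up or down with
  probability \<open>1/2\<close>, and at \<open>0\<close> it moves to \<open>1\<close> or stays, again with probability \<open>1/2\<close>, because a
  horizontal step of the comb is a step that does not change the height. This is the simple random
  walk on the integers folded about the point \<open>-1/2\<close>. If \<open>T\<close> denotes averaging over the two
  neighbours (\<open>nbr_mean\<close>), a function that is symmetric about \<open>-1/2\<close> is therefore averaged by a
  step of the comb in the same way as by \<open>T\<close>.

  The probability that the height stays below \<open>h\<close> up to time \<open>n\<close> solves the discrete heat equation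
  on \<open>{0..<h}\<close> with value \<open>0\<close> at \<open>h\<close> and initial value \<open>1\<close>. By the reflection principle it is
  \<open>(T ^^ n) s\<close> at \<open>0\<close>, where \<open>s\<close> is the square wave that equals \<open>1\<close> on \<open>{0..<h}\<close>, is symmetric about
  \<open>-1/2\<close> and antisymmetric about \<open>h\<close>; both symmetries survive averaging, and the second one gives
  the boundary value. Summing over \<open>h\<close> (\<open>expectation_max_height\<close>), the expected maximum is
  \<open>T ^^ n\<close> applied to \<open>\<Sum>\<^sub>h (1 - s\<^sub>h)\<close>.

  With \<open>Z = \<bar>2 x + 1\<bar>\<close>, the value \<open>1 - s\<^sub>h(x)\<close> is \<open>2 \<Sum>\<^sub>k (-1)\<^sup>k [Z > (2 h + 1) (2 k + 1)]\<close> up to ties.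
  For each \<open>k\<close> about \<open>Z / (2 (2 k + 1))\<close> of the \<open>h\<close> contribute, so Leibniz' series gives
  \<open>\<Sum>\<^sub>h (1 - s\<^sub>h(x)) \<approx> (\<pi> / 4) Z\<close> with a relative error that vanishes as \<open>Z\<close> grows
  (\<open>sum_one_minus_wave_approx\<close>). Finally \<open>T ^^ n\<close> applied to \<open>Z\<close> has a closed form in terms of the
  central binomial coefficients, and Wallis' product shows that it is asymptotic to \<open>sqrt (8 n / \<pi>)\<close>
  (\<open>abs_mean_asymp\<close>). The product of the two constants is \<open>sqrt (\<pi> / 2)\<close>.
\<close>

section \<open>Averaging over the two neighbours of an integer\<close>

definition nbr_mean :: "(int \<Rightarrow> real) \<Rightarrow> int \<Rightarrow> real" where
  "nbr_mean f x = (f (x - 1) + f (x + 1)) / 2"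

text \<open>
  The explicit form reduces linearity, monotonicity and locality of the iterates to the same
  properties of finite sums.
\<close>

lemma nbr_mean_funpow_eq_binomial_sum:
  "(nbr_mean ^^ n) f x = (\<Sum>k\<le>n. real (n choose k) * f (x + 2 * int k - int n)) / 2 ^ n"
proof (induction n arbitrary: x)
  case 0
  then show ?case by simp
next
  case (Suc n)
  define g where "g k = f (x + 2 * int k - int (Suc n))" for k
  have left: "(\<Sum>k\<le>n. real (n choose k) * f (x - 1 + 2 * int k - int n))
      = (\<Sum>k\<le>n. real (n choose k) * g k)"
    by (simp add: g_def algebra_simps)
  have "\<dots> = (\<Sum>k\<le>Suc n. real (n choose k) * g k)"
    by simp
  also have "\<dots> = g 0 + (\<Sum>k\<le>n. real (n choose Suc k) * g (Suc k))"
    by (subst sum.atMost_Suc_shift) simp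
  finally have left': "(\<Sum>k\<le>n. real (n choose k) * g k)
      = g 0 + (\<Sum>k\<le>n. real (n choose Suc k) * g (Suc k))" .
  have right: "(\<Sum>k\<le>n. real (n choose k) * f (x + 1 + 2 * int k - int n))
      = (\<Sum>k\<le>n. real (n choose k) * g (Suc k))"
    by (simp add: g_def algebra_simps)
  have "(\<Sum>k\<le>Suc n. real (Suc n choose k) * g k)
      = g 0 + (\<Sum>k\<le>n. real (Suc n choose Suc k) * g (Suc k))"
    by (subst sum.atMost_Suc_shift) simp
  also have "\<dots> = (\<Sum>k\<le>n. real (n choose k) * g k) + (\<Sum>k\<le>n. real (n choose k) * g (Suc k))"
    unfolding left' by (simp add: sum.distrib algebra_simps)
  finally have pascal: "(\<Sum>k\<le>Suc n. real (Suc n choose k) * g k)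
      = (\<Sum>k\<le>n. real (n choose k) * g k) + (\<Sum>k\<le>n. real (n choose k) * g (Suc k))" .
  have "(nbr_mean ^^ Suc n) f x = ((nbr_mean ^^ n) f (x - 1) + (nbr_mean ^^ n) f (x + 1)) / 2"
    by (simp add: nbr_mean_def)
  also have "\<dots> = (\<Sum>k\<le>Suc n. real (Suc n choose k) * g k) / 2 ^ Suc n"
    unfolding Suc.IH left right pascal by (simp add: add_divide_distrib)
  finally show ?case
    unfolding g_def .
qed

text \<open>
  A walk of \<open>n\<close> steps stays within distance \<open>n\<close>, so it is enough to compare the two functions
  there; this is what makes a number of levels that depends on \<open>n\<close> harmless below.
\<close>

lemma nbr_mean_funpow_mono:
  assumes "\<And>y. \<bar>y - x\<bar> \<le> int n \<Longrightarrow> f y \<le> g y"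
  shows "(nbr_mean ^^ n) f x \<le> (nbr_mean ^^ n) g x"
  unfolding nbr_mean_funpow_eq_binomial_sum
  by (intro divide_right_mono sum_mono mult_left_mono assms) auto

lemma nbr_mean_funpow_add:
  "(nbr_mean ^^ n) (\<lambda>y. f y + g y) x = (nbr_mean ^^ n) f x + (nbr_mean ^^ n) g x"
  by (simp add: nbr_mean_funpow_eq_binomial_sum sum.distrib add_divide_distrib algebra_simps)

lemma nbr_mean_funpow_cmult:
  "(nbr_mean ^^ n) (\<lambda>y. c * f y) x = c * (nbr_mean ^^ n) f x"
  by (simp add: nbr_mean_funpow_eq_binomial_sum sum_distrib_left algebra_simps)

lemma nbr_mean_funpow_diff:
  "(nbr_mean ^^ n) (\<lambda>y. f y - g y) x = (nbr_mean ^^ n) f x - (nbr_mean ^^ n) g x"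
  using nbr_mean_funpow_add[of n f "\<lambda>y. - 1 * g y" x] nbr_mean_funpow_cmult[of n "- 1" g x] by simp

lemma nbr_mean_funpow_const: "(nbr_mean ^^ n) (\<lambda>y. c) = (\<lambda>y. c)"
  by (induction n) (auto simp: nbr_mean_def fun_eq_iff)

lemma nbr_mean_funpow_sum:
  "(nbr_mean ^^ n) (\<lambda>y. \<Sum>i\<in>I. f i y) x = (\<Sum>i\<in>I. (nbr_mean ^^ n) (f i) x)"
proof (induction I rule: infinite_finite_induct)
  case (insert i I)
  then show ?case by (simp add: nbr_mean_funpow_add)
qed (simp_all add: nbr_mean_funpow_const)

text \<open>
  Reflections of the integers permute the pairs of neighbours, hence commute with averaging. Taking
  \<open>a = 1\<close> propagates symmetry and \<open>a = -1\<close> propagates antisymmetry, in the latter case forcing a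
  zero at the centre of reflection.
\<close>

lemma nbr_mean_funpow_reflect:
  assumes "\<And>y. f (c - y) = a * f y"
  shows "(nbr_mean ^^ n) f (c - y) = a * (nbr_mean ^^ n) f y"
proof (induction n arbitrary: y)
  case 0
  then show ?case using assms by simp
next
  case (Suc n)
  show ?case
    using Suc.IH[of "y - 1"] Suc.IH[of "y + 1"] by (simp add: nbr_mean_def algebra_simps)
qed

section \<open>The square wave of the reflection principle\<close>

text \<open>
  The square wave with value \<open>1\<close> on the open interval of half-width \<open>h + 1/2\<close> about \<open>-1/2\<close>, and
  with sign changes (and value \<open>0\<close>) at the odd multiples of \<open>h + 1/2\<close> from that centre. Writing it
  as the sign of a cosine makes all its reflection symmetries symmetries of the cosine.
\<close>

definition wave :: "nat \<Rightarrow> int \<Rightarrow> real" where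
  "wave h x = sgn (cos (pi * (2 * real_of_int x + 1) / (2 * (2 * real h + 1))))"

lemma wave_reflect: "wave h (- 1 - x) = wave h x"
proof -
  have "pi * (2 * real_of_int (- 1 - x) + 1) / (2 * (2 * real h + 1))
      = - (pi * (2 * real_of_int x + 1) / (2 * (2 * real h + 1)))"
    by (simp add: field_simps)
  then show ?thesis unfolding wave_def by (simp only: cos_minus)
qed

lemma wave_antisym: "wave h (2 * int h - x) = - wave h x"
proof -
  have "pi * (2 * real_of_int (2 * int h - x) + 1) / (2 * (2 * real h + 1))
      = pi - (pi * (2 * real_of_int x + 1) / (2 * (2 * real h + 1)))"
    by (simp add: field_simps)
  then show ?thesis unfolding wave_def by (simp only: cos_pi_minus sgn_minus)
qed

lemma wave_inside:
  assumes "0 \<le> x" "x < int h"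
  shows "wave h x = 1"
proof -
  have "pi * (2 * real_of_int x + 1) < pi * (2 * real h + 1)"
    using assms by (intro mult_strict_left_mono) auto
  then have "pi * (2 * real_of_int x + 1) / (2 * (2 * real h + 1)) < pi / 2"
    by (simp add: field_simps)
  moreover have "0 \<le> pi * (2 * real_of_int x + 1) / (2 * (2 * real h + 1))"
    using assms by simp
  ultimately have "cos (pi * (2 * real_of_int x + 1) / (2 * (2 * real h + 1))) > 0"
    by (intro cos_gt_zero_pi) (use pi_gt_zero in linarith)+
  then show ?thesis by (simp add: wave_def)
qed

lemma nbr_mean_funpow_wave_zero: "(nbr_mean ^^ n) (wave h) (int h) = 0"
  using nbr_mean_funpow_reflect[of "wave h" "2 * int h" "- 1" n "int h"] wave_antisym[of h] by simp

lemma nbr_mean_funpow_wave_reflect: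
  "(nbr_mean ^^ n) (wave h) (- 1 - x) = (nbr_mean ^^ n) (wave h) x"
  using nbr_mean_funpow_reflect[of "wave h" "- 1" "1" n x] wave_reflect[of h] by simp

lemma sgn_cos_near_even:
  fixes t :: real
  assumes "\<bar>t - 2 * real m\<bar> < 1"
  shows "sgn (cos (pi * t / 2)) = (- 1) ^ m"
proof -
  define u where "u = pi * (t - 2 * real m) / 2"
  have "pi * \<bar>t - 2 * real m\<bar> < pi * 1"
    using assms by (intro mult_strict_left_mono) auto
  then have "\<bar>u\<bar> < pi / 2"
    by (simp add: u_def abs_mult)
  then have "cos u > 0"
    by (intro cos_gt_zero_pi) auto
  moreover have eq: "pi * t / 2 = u + real m * pi"
    by (simp add: u_def field_simps)
  have "cos (pi * t / 2) = (- 1) ^ m * cos u"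
    unfolding eq cos_add by (simp add: mult.commute)
  ultimately show ?thesis
    by (cases "even m") auto
qed

lemma sum_neg_one_powers: "(\<Sum>k<N. (- 1) ^ k * 2) = 1 - (- 1 :: real) ^ N"
  by (induction N) auto

text \<open>
  Each odd integer \<open>2 k + 1\<close> below \<open>t\<close> flips the sign of \<open>cos (pi t / 2)\<close>, so the square wave is an
  alternating sum of unit steps. Steps are written as \<open>1 + sgn\<close>, which takes half its final value at
  the jump, in accordance with the value \<open>0\<close> of the wave there.
\<close>

lemma one_minus_sgn_cos_eq_alternating_steps:
  fixes t :: real
  assumes "0 \<le> t" "t < 2 * real N + 1"
  shows "1 - sgn (cos (pi * t / 2)) = (\<Sum>k<N. (- 1) ^ k * (1 + sgn (t - (2 * real k + 1))))"
  using assms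
proof (induction N)
  case 0
  then show ?case using sgn_cos_near_even[of t 0] by simp
next
  case (Suc N)
  show ?case
  proof (cases "t < 2 * real N + 1")
    case True
    then show ?thesis using Suc by simp
  next
    case False
    have "(\<Sum>k<N. (- 1) ^ k * (1 + sgn (t - (2 * real k + 1)))) = (\<Sum>k<N. (- 1) ^ k * 2)"
      using False by (intro sum.cong) auto
    then have sum: "(\<Sum>k<N. (- 1) ^ k * (1 + sgn (t - (2 * real k + 1)))) = 1 - (- 1) ^ N"
      by (simp only: sum_neg_one_powers)
    show ?thesis
    proof (cases "t = 2 * real N + 1")
      case True
      have eq: "pi * t / 2 = pi / 2 + real N * pi"
        using True by (simp add: field_simps)
      have "cos (pi * t / 2) = 0"
        unfolding eq cos_add by simp
      then show ?thesis using sum True by simp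
    next
      case False
      then have "t > 2 * real N + 1" using \<open>\<not> t < _\<close> by simp
      moreover have "sgn (cos (pi * t / 2)) = (- 1) ^ Suc N"
        using Suc.prems \<open>t > 2 * real N + 1\<close> by (intro sgn_cos_near_even) auto
      ultimately show ?thesis using sum by simp
    qed
  qed
qed

text \<open>
  The sum is twice the number of odd integers \<open>3, 5, \<dots>, 2 n + 1\<close> below \<open>y\<close>, a tie counting half.
\<close>

lemma odd_count_bounds:
  fixes y :: real
  assumes "0 \<le> y" "y \<le> 2 * real n + 3"
  shows "(\<Sum>h=1..n. 1 + sgn (y - (2 * real h + 1))) \<in> {y - 3..y}"
  using assms
proof (induction n)
  case 0
  then show ?case by simp
next
  case (Suc n)
  show ?case
  proof (cases "y < 2 * real n + 3")
    case True
    then show ?thesis using Suc by simp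
  next
    case False
    have "(\<Sum>h=1..n. 1 + sgn (y - (2 * real h + 1))) = (\<Sum>h=1..n. 2)"
      using False by (intro sum.cong) auto
    then show ?thesis using False Suc.prems by (cases "y = 2 * real n + 3") auto
  qed
qed

lemma alternating_sum_bounds:
  fixes a :: "nat \<Rightarrow> real"
  assumes "\<And>k. 0 \<le> a k" "\<And>k. a (Suc k) \<le> a k"
  shows "(\<Sum>k<N. (- 1) ^ k * a k) \<in> {0..a 0}"
  using assms
proof (induction N arbitrary: a)
  case 0
  then show ?case by simp
next
  case (Suc N)
  have "(\<Sum>k<Suc N. (- 1) ^ k * a k) = a 0 - (\<Sum>k<N. (- 1) ^ k * a (Suc k))"
    by (subst sum.lessThan_Suc_shift) (simp add: sum_negf)
  moreover have "(\<Sum>k<N. (- 1) ^ k * a (Suc k)) \<in> {0..a (Suc 0)}"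
    using Suc.IH[of "\<lambda>k. a (Suc k)"] Suc.prems by simp
  ultimately show ?case using Suc.prems(2)[of 0] by simp
qed

lemma wave_eq_sgn_cos_abs:
  "wave h x = sgn (cos (pi * (\<bar>2 * real_of_int x + 1\<bar> / (2 * real h + 1)) / 2))"
proof -
  have "\<bar>pi * (2 * real_of_int x + 1) / (2 * (2 * real h + 1))\<bar>
      = pi * (\<bar>2 * real_of_int x + 1\<bar> / (2 * real h + 1)) / 2"
    by (simp add: abs_mult)
  then show ?thesis
    unfolding wave_def by (metis cos_abs_real)
qed

text \<open>
  Writing each wave as an alternating sum of steps and exchanging the sums gives an alternating sum
  over \<open>k\<close> of twice the number of \<open>h\<close> with \<open>(2 h + 1) (2 k + 1) \<le> Z\<close>, ties counting half. The first \<open>K\<close>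
  terms differ from \<open>Z / (2 k + 1)\<close> by at most \<open>3\<close> each; the others do not increase with \<open>k\<close>, so their alternating sum is at most the first
  omitted one, which is at most \<open>Z / (2 K + 1)\<close>. The hypothesis on \<open>x\<close> says that the levels up to \<open>n\<close>
  are all those that matter.
\<close>

lemma sum_one_minus_wave_approx:
  fixes x :: int and n K :: nat
  assumes "\<bar>x\<bar> \<le> int n"
  defines "Z \<equiv> \<bar>2 * real_of_int x + 1\<bar>"
  shows "\<bar>(\<Sum>h=1..n. 1 - wave h x) - pi / 4 * Z\<bar>
    \<le> 3 * real K + (1 / (2 * real K + 1) + \<bar>(\<Sum>k<K. (- 1) ^ k / (2 * real k + 1)) - pi / 4\<bar>) * Z"
proof -
  define L where "L = (\<Sum>k<K. (- 1) ^ k / (2 * real k + 1))"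
  define N where "N = Suc n"
  define a where "a k = (\<Sum>h=1..n. 1 + sgn (Z / (2 * real k + 1) - (2 * real h + 1)))" for k
  have Z: "0 \<le> Z" "Z \<le> 2 * real n + 1"
    using assms(1) unfolding Z_def by linarith+
  \<comment> \<open>The condition \<open>(2 h + 1) (2 k + 1) \<le> Z\<close> is symmetric in \<open>h\<close> and \<open>k\<close>.\<close>
  have step: "1 + sgn (Z / (2 * real h + 1) - (2 * real k + 1))
      = 1 + sgn (Z / (2 * real k + 1) - (2 * real h + 1))" for h k
  proof -
    have "Z / (2 * real h + 1) - (2 * real k + 1)
        = (Z - (2 * real h + 1) * (2 * real k + 1)) / (2 * real h + 1)"
      "Z / (2 * real k + 1) - (2 * real h + 1)
        = (Z - (2 * real h + 1) * (2 * real k + 1)) / (2 * real k + 1)"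
      by (simp_all add: field_simps)
    then show ?thesis by (simp add: sgn_divide)
  qed
  have "(\<Sum>h=1..n. 1 - wave h x)
      = (\<Sum>h=1..n. \<Sum>k<N + K. (- 1) ^ k * (1 + sgn (Z / (2 * real h + 1) - (2 * real k + 1))))"
  proof (intro sum.cong refl)
    fix h assume "h \<in> {1..n}"
    have "Z / (2 * real h + 1) \<le> Z / 1"
      using Z by (intro divide_left_mono) auto
    then have "Z / (2 * real h + 1) < 2 * real (N + K) + 1"
      using Z by (simp add: N_def)
    then show "1 - wave h x
      = (\<Sum>k<N + K. (- 1) ^ k * (1 + sgn (Z / (2 * real h + 1) - (2 * real k + 1))))"
      unfolding wave_eq_sgn_cos_abs Z_def[symmetric]
      using Z by (intro one_minus_sgn_cos_eq_alternating_steps) auto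
  qed
  also have "\<dots> = (\<Sum>k<N + K. \<Sum>h=1..n. (- 1) ^ k * (1 + sgn (Z / (2 * real k + 1) - (2 * real h + 1))))"
    by (subst sum.swap) (intro sum.cong refl arg_cong[OF step])
  also have "\<dots> = (\<Sum>k<N + K. (- 1) ^ k * a k)"
    unfolding a_def sum_distrib_left ..
  also have "{..<N + K} = {..<K} \<union> {K..<K + N}"
    by auto
  also have "(\<Sum>k\<in>\<dots>. (- 1) ^ k * a k)
      = (\<Sum>k<K. (- 1) ^ k * a k) + (\<Sum>k=K..<K + N. (- 1) ^ k * a k)"
    by (intro sum.union_disjoint) auto
  also have "(\<Sum>k=K..<K + N. (- 1) ^ k * a k) = (- 1) ^ K * (\<Sum>k<N. (- 1) ^ k * a (k + K))"
    using sum.shift_bounds_nat_ivl[of "\<lambda>k. (- 1) ^ k * a k" 0 K N]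
    by (simp add: sum_distrib_left power_add algebra_simps lessThan_atLeast0)
  finally have G: "(\<Sum>h=1..n. 1 - wave h x)
      = (\<Sum>k<K. (- 1) ^ k * a k) + (- 1) ^ K * (\<Sum>k<N. (- 1) ^ k * a (k + K))" .
  have a: "a k \<in> {Z / (2 * real k + 1) - 3..Z / (2 * real k + 1)}" for k
  proof -
    have "Z / (2 * real k + 1) \<le> Z / 1"
      using Z by (intro divide_left_mono) auto
    then show ?thesis
      unfolding a_def using Z by (intro odd_count_bounds) auto
  qed
  have tail: "\<bar>(- 1) ^ K * (\<Sum>k<N. (- 1) ^ k * a (k + K))\<bar> \<le> Z / (2 * real K + 1)"
  proof -
    have sgn_mono: "sgn u \<le> sgn v" if "u \<le> v" for u v :: real
      using that by (auto simp: sgn_real_def)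
    have "(\<Sum>k<N. (- 1) ^ k * a (k + K)) \<in> {0..a (0 + K)}"
    proof (rule alternating_sum_bounds)
      fix k
      show "0 \<le> a (k + K)"
        unfolding a_def by (intro sum_nonneg) (auto simp: sgn_real_def)
      show "a (Suc k + K) \<le> a (k + K)"
        unfolding a_def using Z
        by (intro sum_mono add_left_mono sgn_mono diff_right_mono divide_left_mono) auto
    qed
    then show ?thesis using a[of K] by (simp add: abs_mult)
  qed
  have "\<bar>(\<Sum>k<K. (- 1) ^ k * a k) - L * Z\<bar>
      = \<bar>\<Sum>k<K. (- 1) ^ k * (a k - Z / (2 * real k + 1))\<bar>"
    unfolding L_def sum_distrib_right sum_subtractf[symmetric] by (simp add: right_diff_distrib)
  also have "\<dots> \<le> (\<Sum>k<K. \<bar>(- 1) ^ k * (a k - Z / (2 * real k + 1))\<bar>)"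
    by (rule sum_abs)
  also have "\<dots> \<le> (\<Sum>k<K. 3)"
  proof (intro sum_mono)
    fix k
    show "\<bar>(- 1) ^ k * (a k - Z / (2 * real k + 1))\<bar> \<le> 3"
      using a[of k] unfolding abs_mult by (simp add: abs_le_iff)
  qed
  finally have head: "\<bar>(\<Sum>k<K. (- 1) ^ k * a k) - L * Z\<bar> \<le> 3 * real K"
    by simp
  have "\<bar>L * Z - pi / 4 * Z\<bar> = \<bar>L - pi / 4\<bar> * Z"
    unfolding left_diff_distrib[symmetric] abs_mult using Z by simp
  with head tail show ?thesis
    unfolding G L_def[symmetric] by (simp add: algebra_simps)
qed

section \<open>The mean absolute value of the simple random walk on the integers\<close>

text \<open>
  \<open>\<bar>2 x + 1\<bar>\<close> is harmonic except at \<open>0\<close> and \<open>-1\<close>, where averaging increases it by \<open>1\<close>. The mean thus grows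
  by the probability that the walk is at one of these two points, and parity leaves exactly one of
  them.
\<close>

lemma abs_mean_Suc:
  "(nbr_mean ^^ Suc n) (\<lambda>x. \<bar>2 * real_of_int x + 1\<bar>) 0
    = (nbr_mean ^^ n) (\<lambda>x. \<bar>2 * real_of_int x + 1\<bar>) 0 + real (n choose (n div 2)) / 2 ^ n"
proof -
  define f where "f = (\<lambda>x. \<bar>2 * real_of_int x + 1\<bar>)"
  define p where "p = (\<lambda>x::int. of_bool (x = 0 \<or> x = - 1) :: real)"
  have "nbr_mean f = (\<lambda>x. f x + p x)"
  proof
    fix x :: int
    consider "x = 0" | "x = - 1" | "x \<ge> 1" | "x \<le> - 2" by linarith
    then show "nbr_mean f x = f x + p x"
      by cases (auto simp: nbr_mean_def f_def p_def)
  qed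
  then have "(nbr_mean ^^ Suc n) f 0 = (nbr_mean ^^ n) f 0 + (nbr_mean ^^ n) p 0"
    by (simp add: funpow_swap1 nbr_mean_funpow_add del: funpow.simps(2) add: funpow_Suc_right)
  also have "(nbr_mean ^^ n) p 0 = (\<Sum>k\<le>n. if k = n div 2 then real (n choose k) else 0) / 2 ^ n"
    unfolding nbr_mean_funpow_eq_binomial_sum p_def
    by (intro arg_cong2[where f = "(/)"] sum.cong) auto
  also have "\<dots> = real (n choose (n div 2)) / 2 ^ n"
    by simp
  finally show ?thesis unfolding f_def .
qed

definition central_prob :: "nat \<Rightarrow> real" where
  "central_prob m = real (2 * m choose m) / 4 ^ m"

lemma central_prob_odd: "real (Suc (2 * m) choose m) / 2 ^ Suc (2 * m) = central_prob (Suc m)"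
  using central_binomial_odd[of "Suc (2 * m)"] by (simp add: central_prob_def power_mult)

lemma central_prob_Suc: "central_prob (Suc m) = central_prob m * (2 * real m + 1) / (2 * real m + 2)"
proof -
  have "Suc m * (Suc (2 * m) choose m) = Suc (2 * m) * (2 * m choose m)"
    using Suc_times_binomial[of m "2 * m"] central_binomial_odd[of "Suc (2 * m)"] by simp
  then have "(real m + 1) * real (Suc (2 * m) choose m) = (2 * real m + 1) * real (2 * m choose m)"
    by (metis of_nat_Suc of_nat_mult of_nat_numeral add.commute)
  then have "real (Suc (2 * m) choose m) = real (2 * m choose m) * (2 * real m + 1) / (real m + 1)"
    by (simp add: field_simps)
  then show ?thesis
    unfolding central_prob_odd[symmetric]
    by (simp add: central_prob_def power_mult divide_simps del: binomial_Suc_Suc)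
      (simp add: algebra_simps del: binomial_Suc_Suc)
qed

text \<open>
  The increments are central binomial probabilities, and their partial sums telescope.
\<close>

lemma abs_mean_closed_form:
  "(nbr_mean ^^ (2 * m)) (\<lambda>x. \<bar>2 * real_of_int x + 1\<bar>) 0 = (4 * real m + 1) * central_prob m"
  "(nbr_mean ^^ Suc (2 * m)) (\<lambda>x. \<bar>2 * real_of_int x + 1\<bar>) 0 = (4 * real m + 2) * central_prob m"
proof -
  have central: "real (2 * m choose m) / 2 ^ (2 * m) = central_prob m" for m
    by (simp add: central_prob_def power_mult)
  show even: "(nbr_mean ^^ (2 * m)) (\<lambda>x. \<bar>2 * real_of_int x + 1\<bar>) 0 = (4 * real m + 1) * central_prob m"
  for m
  proof (induction m)
    case 0
    then show ?case by (simp add: central_prob_def)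
  next
    case (Suc m)
    have "(nbr_mean ^^ (2 * Suc m)) (\<lambda>x. \<bar>2 * real_of_int x + 1\<bar>) 0
        = (4 * real m + 1) * central_prob m + central_prob m + central_prob (Suc m)"
      using abs_mean_Suc[of "Suc (2 * m)"] abs_mean_Suc[of "2 * m"] Suc central_prob_odd[of m]
        central[of m]
      by (simp del: funpow.simps)
    also have "\<dots> = (4 * real (Suc m) + 1) * central_prob (Suc m)"
      unfolding central_prob_Suc by (simp add: field_simps)
    finally show ?case .
  qed
  show "(nbr_mean ^^ Suc (2 * m)) (\<lambda>x. \<bar>2 * real_of_int x + 1\<bar>) 0 = (4 * real m + 2) * central_prob m"
    using abs_mean_Suc[of "2 * m"] even[of m] central[of m]
    by (simp add: algebra_simps del: funpow.simps)
qed

lemma central_prob_wallis: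
  "(2 * real m + 1) * (central_prob m)\<^sup>2 * (\<Prod>k=1..m. (4 * real k ^ 2) / (4 * real k ^ 2 - 1)) = 1"
proof (induction m)
  case 0
  then show ?case by (simp add: central_prob_def)
next
  case (Suc m)
  define W where "W = (\<Prod>k=1..m. (4 * real k ^ 2) / (4 * real k ^ 2 - 1))"
  have cancel: "b * (p * a / c)\<^sup>2 * (c\<^sup>2 / (a * b)) = a * p\<^sup>2" if "a \<noteq> 0" "b \<noteq> 0" "c \<noteq> 0"
    for a b c p :: real
    using that by (simp add: power_mult_distrib power_divide power2_eq_square)
  have factors: "2 * real (Suc m) + 1 = 2 * real m + 3" "4 * real (Suc m) ^ 2 = (2 * real m + 2)\<^sup>2"
    "(2 * real m + 2)\<^sup>2 - 1 = (2 * real m + 1) * (2 * real m + 3)"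
    by (simp_all add: power2_eq_square algebra_simps)
  have step: "(2 * real (Suc m) + 1) * (central_prob (Suc m))\<^sup>2
        * ((4 * real (Suc m) ^ 2) / (4 * real (Suc m) ^ 2 - 1))
      = (2 * real m + 1) * (central_prob m)\<^sup>2"
    unfolding factors central_prob_Suc by (rule cancel) auto
  have "(\<Prod>k=1..Suc m. (4 * real k ^ 2) / (4 * real k ^ 2 - 1))
      = (4 * real (Suc m) ^ 2) / (4 * real (Suc m) ^ 2 - 1) * W"
    unfolding W_def by (simp add: mult.commute)
  then show ?case
    using Suc.IH unfolding W_def[symmetric] by (simp only: mult.assoc[symmetric] step)
qed

lemma central_prob_asymp: "(\<lambda>m. (2 * real m + 1) * (central_prob m)\<^sup>2) \<longlonglongrightarrow> 2 / pi"
proof -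
  have "(\<lambda>m. (2 * real m + 1) * (central_prob m)\<^sup>2)
      = (\<lambda>m. inverse (\<Prod>k=1..m. (4 * real k ^ 2) / (4 * real k ^ 2 - 1)))"
    by (intro ext inverse_unique[symmetric]) (subst mult.commute, rule central_prob_wallis)
  then show ?thesis
    using tendsto_inverse[OF wallis] by simp
qed

lemma abs_mean_asymp:
  "(\<lambda>n. (nbr_mean ^^ n) (\<lambda>x. \<bar>2 * real_of_int x + 1\<bar>) 0 / sqrt (real n)) \<longlonglongrightarrow> sqrt (8 / pi)"
proof -
  define A where "A n = (nbr_mean ^^ n) (\<lambda>x. \<bar>2 * real_of_int x + 1\<bar>) 0" for n
  \<comment> \<open>The even and the odd case of the closed form differ only by this vanishing correction.\<close>
  define d :: "nat \<Rightarrow> real" where "d n = of_bool (even n) / real n" for n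
  have d: "d \<longlonglongrightarrow> 0"
    by (rule tendsto_sandwich[OF _ _ tendsto_const lim_inverse_n']) (auto simp: d_def)
  have A_eq: "A n = (2 * real n + of_bool (even n)) * central_prob (n div 2)" for n
    using abs_mean_closed_form[of "n div 2"]
    by (cases "even n") (auto elim!: evenE oddE simp: A_def)
  have "(A n)\<^sup>2 / real n = (2 * real (n div 2) + 1) * (central_prob (n div 2))\<^sup>2
      * ((2 + d n)\<^sup>2 / (1 + d n))" if "n > 0" for n
  proof -
    have "2 * real (n div 2) + 1 = real n + of_bool (even n)"
      by (cases "even n") (auto simp: real_of_nat_div elim!: oddE)
    then have q: "2 * real (n div 2) + 1 = real n * (1 + d n)"
      using that by (simp add: d_def distrib_left)
    have A: "A n = real n * (2 + d n) * central_prob (n div 2)"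
      using that unfolding A_eq by (simp add: d_def distrib_left mult.commute)
    have "1 + d n > 0"
      by (simp add: d_def add_pos_nonneg)
    then show ?thesis
      using that unfolding A q by (simp add: power_mult_distrib) (simp add: power2_eq_square)
  qed
  then have "\<forall>\<^sub>F n in sequentially. (2 * real (n div 2) + 1) * (central_prob (n div 2))\<^sup>2
      * ((2 + d n)\<^sup>2 / (1 + d n)) = (A n)\<^sup>2 / real n"
    by (intro eventually_mono[OF eventually_gt_at_top[of 0]]) auto
  moreover have "(\<lambda>n. (2 * real (n div 2) + 1) * (central_prob (n div 2))\<^sup>2
      * ((2 + d n)\<^sup>2 / (1 + d n))) \<longlonglongrightarrow> 2 / pi * ((2 + 0)\<^sup>2 / (1 + 0))"
    by (intro tendsto_mult tendsto_divide tendsto_power tendsto_add tendsto_const d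
        filterlim_compose[OF central_prob_asymp] filterlim_at_top_div_const_nat) auto
  ultimately have "(\<lambda>n. (A n)\<^sup>2 / real n) \<longlonglongrightarrow> 8 / pi"
    by (auto dest: Lim_transform_eventually)
  then have "(\<lambda>n. sqrt ((A n)\<^sup>2 / real n)) \<longlonglongrightarrow> sqrt (8 / pi)"
    by (rule tendsto_real_sqrt)
  moreover have "A n \<ge> 0" for n
    unfolding A_eq by (simp add: central_prob_def)
  ultimately show ?thesis
    by (simp add: A_def real_sqrt_divide)
qed

section \<open>Leibniz' series and the mean number of levels reached\<close>

lemma leibniz_partial_sums: "(\<lambda>K. \<Sum>k<K. (- 1) ^ k / (2 * real k + 1)) \<longlonglongrightarrow> pi / 4"
proof -
  have "summable (\<lambda>k. (- 1) ^ k * (1 / real (k * 2 + 1) * 1 ^ (k * 2 + 1)) :: real)"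
    by (rule summable_arctan_series) simp
  then have "(\<lambda>k. (- 1) ^ k * 1 / real (k * 2 + 1)) sums (pi / 4)"
    unfolding pi_series by (intro summable_sums) simp
  then show ?thesis
    by (simp add: sums_def mult.commute add.commute)
qed

text \<open>
  Averaging the estimate for the sum of the waves bounds the difference of the quotient from \<open>pi / 4\<close> by
  \<open>3 K / A n + \<delta> K\<close>. Since the mean absolute value \<open>A n\<close> tends to infinity, one lets \<open>n\<close> grow first and
  then \<open>K\<close>, where \<open>\<delta> K\<close> tends to \<open>0\<close> by Leibniz' series.
\<close>

lemma expected_height_over_abs_mean:
  "(\<lambda>n. (nbr_mean ^^ n) (\<lambda>y. \<Sum>h=1..n. 1 - wave h y) 0
      / (nbr_mean ^^ n) (\<lambda>x. \<bar>2 * real_of_int x + 1\<bar>) 0) \<longlonglongrightarrow> pi / 4"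
proof (rule LIMSEQ_I)
  define A where "A n = (nbr_mean ^^ n) (\<lambda>x. \<bar>2 * real_of_int x + 1\<bar>) 0" for n
  define E where "E n = (nbr_mean ^^ n) (\<lambda>y. \<Sum>h=1..n. 1 - wave h y) 0" for n
  define \<delta> where "\<delta> K = 1 / (2 * real K + 1) + \<bar>(\<Sum>k<K. (- 1) ^ k / (2 * real k + 1)) - pi / 4\<bar>" for K
  have bound: "\<bar>E n - pi / 4 * A n\<bar> \<le> 3 * real K + \<delta> K * A n" for n K
  proof -
    define Z where "Z = (\<lambda>x::int. \<bar>2 * real_of_int x + 1\<bar>)"
    have "\<bar>(\<Sum>h=1..n. 1 - wave h y) - pi / 4 * Z y\<bar> \<le> 3 * real K + \<delta> K * Z y"
      if "\<bar>y - 0\<bar> \<le> int n" for y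
      using sum_one_minus_wave_approx[of y n K] that by (simp add: Z_def \<delta>_def)
    then have "(\<Sum>h=1..n. 1 - wave h y) \<le> 3 * real K + (pi / 4 + \<delta> K) * Z y"
      "- (3 * real K) + (pi / 4 - \<delta> K) * Z y \<le> (\<Sum>h=1..n. 1 - wave h y)"
      if "\<bar>y - 0\<bar> \<le> int n" for y
      using that by (fastforce simp: algebra_simps abs_le_iff)+
    then have "E n \<le> (nbr_mean ^^ n) (\<lambda>y. 3 * real K + (pi / 4 + \<delta> K) * Z y) 0"
      "(nbr_mean ^^ n) (\<lambda>y. - (3 * real K) + (pi / 4 - \<delta> K) * Z y) 0 \<le> E n"
      unfolding E_def by (auto intro!: nbr_mean_funpow_mono simp del: diff_zero)
    then show ?thesis
      unfolding nbr_mean_funpow_add nbr_mean_funpow_cmult nbr_mean_funpow_const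
      by (simp add: A_def Z_def algebra_simps abs_le_iff)
  qed
  have \<delta>: "\<delta> \<longlonglongrightarrow> 0"
  proof -
    have "(\<lambda>K. 1 / (2 * real K + 1)) \<longlonglongrightarrow> 0"
      by real_asymp
    moreover have "(\<lambda>K. \<bar>(\<Sum>k<K. (- 1) ^ k / (2 * real k + 1)) - pi / 4\<bar>) \<longlonglongrightarrow> \<bar>pi / 4 - pi / 4\<bar>"
      by (intro tendsto_intros leibniz_partial_sums)
    ultimately show ?thesis
      unfolding \<delta>_def using tendsto_add by fastforce
  qed
  have A_top: "filterlim A at_top sequentially"
  proof -
    have "filterlim (\<lambda>n. A n / sqrt (real n) * sqrt (real n)) at_top sequentially"
      by (rule filterlim_tendsto_pos_mult_at_top[OF abs_mean_asymp[folded A_def]])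
         (auto intro: filterlim_compose[OF sqrt_at_top filterlim_real_sequentially])
    moreover have cong: "\<forall>\<^sub>F n in sequentially. A n / sqrt (real n) * sqrt (real n) = A n"
      by (rule eventually_mono[OF eventually_gt_at_top[of 0]]) simp
    ultimately show ?thesis
      by (simp only: filterlim_cong[OF refl refl cong])
  qed
  fix r :: real assume r: "r > 0"
  then obtain K where K: "\<delta> K < r / 2"
    using order_tendstoD(2)[OF \<delta>, of "r / 2"] by (auto simp: eventually_sequentially)
  have "\<forall>\<^sub>F n in sequentially. A n > 6 * real K / r"
    using A_top by (simp add: filterlim_at_top_dense)
  moreover have "\<forall>\<^sub>F n in sequentially. A n > 0"
    using A_top by (simp add: filterlim_at_top_dense)
  ultimately have "\<forall>\<^sub>F n in sequentially. norm (E n / A n - pi / 4) < r"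
  proof eventually_elim
    case (elim n)
    have "\<bar>E n - pi / 4 * A n\<bar> \<le> 3 * real K + \<delta> K * A n"
      by (rule bound)
    also have "3 * real K < r / 2 * A n"
      using elim(1) r by (simp add: field_simps)
    also have "\<delta> K * A n \<le> r / 2 * A n"
      using K elim(2) by (intro mult_right_mono) auto
    finally have "\<bar>E n - pi / 4 * A n\<bar> < r * A n"
      by simp
    moreover have "E n / A n - pi / 4 = (E n - pi / 4 * A n) / A n"
      using elim(2) by (simp add: field_simps)
    ultimately show ?case
      using elim(2) by (simp add: abs_divide pos_divide_less_eq)
  qed
  then show "\<exists>no. \<forall>n\<ge>no. norm (E n / A n - pi / 4) < r"
    by (simp add: eventually_sequentially)
qed

section \<open>The law of the path of a random walk\<close>

text \<open>
  The path up to time \<open>n\<close>, most recent position first, so that the walk prolongs it by consing.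
  Lists over a countable type are again countable, which turns the law of the path into a discrete
  distribution and lets the process be replaced by an iterated bind of such distributions.
\<close>

primrec past :: "(nat \<Rightarrow> 'w \<Rightarrow> 'v) \<Rightarrow> nat \<Rightarrow> 'w \<Rightarrow> 'v list" where
  "past S 0 \<omega> = [S 0 \<omega>]"
| "past S (Suc n) \<omega> = S (Suc n) \<omega> # past S n \<omega>"

primrec walk_past_pmf :: "('v \<Rightarrow> 'v \<Rightarrow> bool) \<Rightarrow> 'v \<Rightarrow> nat \<Rightarrow> 'v list pmf" where
  "walk_past_pmf adj v0 0 = return_pmf [v0]"
| "walk_past_pmf adj v0 (Suc n) = bind_pmf (walk_past_pmf adj v0 n)
     (\<lambda>l. map_pmf (\<lambda>w. w # l) (pmf_of_set (neighbours adj (hd l))))"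

lemma length_past [simp]: "length (past S n \<omega>) = Suc n"
  by (induction n) auto

lemma past_nth: "j \<le> n \<Longrightarrow> past S n \<omega> ! j = S (n - j) \<omega>"
proof (induction n arbitrary: j)
  case (Suc n)
  then show ?case by (cases j) auto
qed simp

lemma past_eq_iff: "past S n \<omega> = l \<longleftrightarrow> length l = Suc n \<and> (\<forall>i\<le>n. S i \<omega> = l ! (n - i))"
proof
  assume "past S n \<omega> = l"
  then show "length l = Suc n \<and> (\<forall>i\<le>n. S i \<omega> = l ! (n - i))"
    by (auto simp: past_nth)
next
  assume l: "length l = Suc n \<and> (\<forall>i\<le>n. S i \<omega> = l ! (n - i))"
  show "past S n \<omega> = l"
  proof (rule nth_equalityI)
    fix j assume "j < length (past S n \<omega>)"
    then have "j \<le> n" by simp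
    then show "past S n \<omega> ! j = l ! j"
      using l[THEN conjunct2, rule_format, of "n - j"] by (simp add: past_nth)
  qed (use l in simp)
qed

lemma set_past: "set (past S n \<omega>) = (\<lambda>i. S i \<omega>) ` {0..n}"
  by (induction n) (auto simp: atLeast0_atMost_Suc)

lemma pmf_walk_past_Cons:
  "pmf (walk_past_pmf adj v0 (Suc n)) (w # l)
    = pmf (walk_past_pmf adj v0 n) l * pmf (pmf_of_set (neighbours adj (hd l))) w"
proof -
  have "pmf (map_pmf (\<lambda>v. v # l') (pmf_of_set (neighbours adj (hd l')))) (w # l)
      = indicator {l} l' * pmf (pmf_of_set (neighbours adj (hd l))) w" for l'
  proof (cases "l' = l")
    case True
    have "pmf (map_pmf (\<lambda>v. v # l) (pmf_of_set (neighbours adj (hd l)))) (w # l)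
        = pmf (pmf_of_set (neighbours adj (hd l))) w"
      by (rule pmf_map_inj') (auto intro: injI)
    with True show ?thesis by simp
  next
    case False
    then have "w # l \<notin> set_pmf (map_pmf (\<lambda>v. v # l') (pmf_of_set (neighbours adj (hd l'))))"
      by auto
    then have "pmf (map_pmf (\<lambda>v. v # l') (pmf_of_set (neighbours adj (hd l')))) (w # l) = 0"
      by (simp only: set_pmf_iff not_not)
    with False show ?thesis by simp
  qed
  then show ?thesis
    by (simp add: pmf_bind measure_pmf_single)
qed

lemma walk_past_nonempty: "[] \<notin> set_pmf (walk_past_pmf adj v0 n)"
  by (cases n) auto

lemma past_sets:
  fixes S :: "nat \<Rightarrow> 'w \<Rightarrow> 'v"
  assumes "\<And>n. S n \<in> measurable M (count_space UNIV)"
  shows "{\<omega> \<in> space M. past S n \<omega> = l} \<in> sets M"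
proof -
  note [measurable] = assms
  show ?thesis unfolding past_eq_iff by measurable
qed

text \<open>
  The conditional law of the next step only speaks about histories of positive probability; a history
  of probability \<open>0\<close> has no prolongation of positive probability either, so the product formula holds
  for all of them.
\<close>

lemma prob_past_eq:
  fixes S :: "nat \<Rightarrow> 'w \<Rightarrow> 'v"
  assumes walk: "simple_random_walk adj v0 M S"
  shows "\<P>(\<omega> in M. past S n \<omega> = l) = pmf (walk_past_pmf adj v0 n) l"
proof (induction n arbitrary: l)
  interpret prob_space M
    using walk by (simp add: simple_random_walk_def)
  have meas: "S k \<in> measurable M (count_space UNIV)" for k
    using walk by (simp add: simple_random_walk_def)
  have step: "\<P>(\<omega> in M. S (Suc m) \<omega> = w \<bar> \<forall>i\<le>m. S i \<omega> = v i)
      = pmf (pmf_of_set (neighbours adj (v m))) w"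
    if "\<P>(\<omega> in M. \<forall>i\<le>m. S i \<omega> = v i) > 0" for m w and v :: "nat \<Rightarrow> 'v"
    using walk that by (simp add: simple_random_walk_def)
  note [measurable] = meas
  {
    case 0
    have start: "AE \<omega> in M. S 0 \<omega> = v0"
      using walk by (simp add: simple_random_walk_def)
    have "\<P>(\<omega> in M. past S 0 \<omega> = l) = \<P>(\<omega> in M. [v0] = l)"
      by (rule measure_eq_AE) (use start past_sets[OF meas, where n = 0 and l = l] in auto)
    then show ?case
      by (simp add: prob_space indicator_def)
  next
    case (Suc n)
    show ?case
    proof (cases l)
      case Nil
      then show ?thesis
        using walk_past_nonempty[of adj v0 "Suc n"]
        by (simp add: pmf_eq_0_set_pmf del: walk_past_pmf.simps)
    next
      case (Cons w k)
      define p where "p = \<P>(\<omega> in M. past S n \<omega> = k)"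
      have joint: "\<P>(\<omega> in M. past S (Suc n) \<omega> = l) = \<P>(\<omega> in M. S (Suc n) \<omega> = w \<and> past S n \<omega> = k)"
        by (simp add: Cons)
      have "\<P>(\<omega> in M. S (Suc n) \<omega> = w \<and> past S n \<omega> = k)
          = p * pmf (pmf_of_set (neighbours adj (hd k))) w"
      proof (cases "p > 0")
        case False
        then have "p = 0"
          unfolding p_def by (simp add: zero_less_measure_iff)
        moreover have "\<P>(\<omega> in M. S (Suc n) \<omega> = w \<and> past S n \<omega> = k) \<le> p"
          unfolding p_def by (intro finite_measure_mono past_sets meas) auto
        ultimately show ?thesis
          using measure_nonneg by (simp add: order_antisym)
      next
        case True
        have "{\<omega> \<in> space M. past S n \<omega> = k} \<noteq> {}"
        proof
          assume "{\<omega> \<in> space M. past S n \<omega> = k} = {}"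
          with True show False unfolding p_def by (simp only: measure_empty less_irrefl)
        qed
        then have len: "length k = Suc n"
          by (auto simp: past_eq_iff)
        then have ev: "past S n \<omega> = k \<longleftrightarrow> (\<forall>i\<le>n. S i \<omega> = k ! (n - i))" for \<omega>
          by (simp add: past_eq_iff)
        have "\<P>(\<omega> in M. S (Suc n) \<omega> = w \<bar> \<forall>i\<le>n. S i \<omega> = k ! (n - i))
            = pmf (pmf_of_set (neighbours adj (k ! (n - n)))) w"
          using step[of n "\<lambda>i. k ! (n - i)" w] True unfolding p_def ev by blast
        moreover have "k ! (n - n) = hd k"
          using len by (cases k) auto
        ultimately have "\<P>(\<omega> in M. S (Suc n) \<omega> = w \<bar> \<forall>i\<le>n. S i \<omega> = k ! (n - i))
            = pmf (pmf_of_set (neighbours adj (hd k))) w"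
          by (simp only:)
        then show ?thesis
          using True unfolding cond_prob_def ev[symmetric] p_def[symmetric] by (simp add: field_simps)
      qed
      then show ?thesis
        unfolding joint p_def Suc.IH by (simp add: Cons pmf_walk_past_Cons del: walk_past_pmf.simps)
    qed
  }
qed

lemma distr_past_eq_walk_past_pmf:
  fixes S :: "nat \<Rightarrow> 'w \<Rightarrow> 'v :: countable"
  assumes walk: "simple_random_walk adj v0 M S"
  shows "past S n \<in> measurable M (count_space UNIV)"
    and "distr M (count_space UNIV) (past S n) = measure_pmf (walk_past_pmf adj v0 n)"
proof -
  interpret prob_space M
    using walk by (simp add: simple_random_walk_def)
  have ev: "past S n -` {l} \<inter> space M = {\<omega> \<in> space M. past S n \<omega> = l}" for l
    by auto
  have "{\<omega> \<in> space M. past S n \<omega> = l} \<in> sets M" for l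
    using walk by (intro past_sets) (simp add: simple_random_walk_def)
  then show meas: "past S n \<in> measurable M (count_space UNIV)"
    by (simp add: measurable_count_space_eq2_countable ev)
  show "distr M (count_space UNIV) (past S n) = measure_pmf (walk_past_pmf adj v0 n)"
  proof (rule measure_eqI_countable[of _ UNIV])
    fix l
    have "emeasure (distr M (count_space UNIV) (past S n)) {l}
        = ennreal (\<P>(\<omega> in M. past S n \<omega> = l))"
      by (simp add: emeasure_distr[OF meas] ev emeasure_eq_measure)
    then show "emeasure (distr M (count_space UNIV) (past S n)) {l}
        = emeasure (measure_pmf (walk_past_pmf adj v0 n)) {l}"
      by (simp add: prob_past_eq[OF walk] emeasure_pmf_single)
  qed auto
qed

section \<open>The height process of the comb\<close>

lemma set_pmf_comb_step: "set_pmf (pmf_of_set (neighbours comb2_adj v)) = neighbours comb2_adj v"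
  by (rule set_pmf_of_set[OF comb2_neighbours_nonempty comb2_neighbours_finite])

lemma comb_step_iff: "w \<in> set_pmf (pmf_of_set (neighbours comb2_adj v)) \<longleftrightarrow> comb2_adj v w"
  unfolding set_pmf_comb_step by (simp add: neighbours_def)

lemma finite_comb_walk_past: "finite (set_pmf (walk_past_pmf comb2_adj v0 n))"
  by (induction n) (auto simp: set_pmf_comb_step comb2_neighbours_finite)

lemma comb_walk_past_height_le:
  assumes "l \<in> set_pmf (walk_past_pmf comb2_adj (x, 0) n)"
  shows "l \<noteq> [] \<and> (\<forall>v\<in>set l. \<bar>snd v\<bar> \<le> int n)"
  using assms
proof (induction n arbitrary: l)
  case 0
  then show ?case by simp
next
  case (Suc n)
  from Suc.prems obtain w k where l: "l = w # k" "k \<in> set_pmf (walk_past_pmf comb2_adj (x, 0) n)"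
    and w: "comb2_adj (hd k) w"
    by (auto simp: comb_step_iff)
  have k: "k \<noteq> []" "\<And>v. v \<in> set k \<Longrightarrow> \<bar>snd v\<bar> \<le> int n"
    using Suc.IH[OF l(2)] by simp_all
  have "\<bar>snd w\<bar> \<le> \<bar>snd (hd k)\<bar> + 1"
    using w unfolding comb2_adj_def by linarith
  then have "\<bar>snd w\<bar> \<le> int (Suc n)"
    using k(2)[OF hd_in_set[OF k(1)]] by simp
  moreover have "\<bar>snd v\<bar> \<le> int (Suc n)" if "v \<in> set k" for v
    using k(2)[OF that] by simp
  ultimately show ?case
    unfolding l by simp
qed

lemma expectation_comb_walk_past_Suc:
  fixes F :: "(int \<times> int) list \<Rightarrow> real"
  shows "measure_pmf.expectation (walk_past_pmf comb2_adj v0 (Suc m)) F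
    = measure_pmf.expectation (walk_past_pmf comb2_adj v0 m)
        (\<lambda>l. measure_pmf.expectation (pmf_of_set (neighbours comb2_adj (hd l))) (\<lambda>w. F (w # l)))"
proof -
  have "measure_pmf.expectation (walk_past_pmf comb2_adj v0 (Suc m)) F
      = (\<Sum>l\<in>set_pmf (walk_past_pmf comb2_adj v0 m). pmf (walk_past_pmf comb2_adj v0 m) l *\<^sub>R
          measure_pmf.expectation (map_pmf (\<lambda>w. w # l) (pmf_of_set (neighbours comb2_adj (hd l)))) F)"
    unfolding walk_past_pmf.simps
    by (rule pmf_expectation_bind)
       (auto simp: finite_comb_walk_past set_pmf_comb_step comb2_neighbours_finite)
  then show ?thesis
    by (subst integral_measure_pmf[OF finite_comb_walk_past]) (auto simp: o_def)
qed

text \<open>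
  The folding of the integers about \<open>-1/2\<close>: on the axis two of the four neighbours have height \<open>1\<close> and two
  keep height \<open>0\<close>. Extended symmetrically, \<open>g\<close> has the value \<open>g 0\<close> at the neighbour \<open>-1\<close> of \<open>0\<close>, so both cases are
  a plain average over the two neighbours of the height.
\<close>

lemma expectation_comb_step_height:
  assumes "g (- 1) = g 0"
  shows "measure_pmf.expectation (pmf_of_set (neighbours comb2_adj v)) (\<lambda>w. g \<bar>snd w\<bar>)
    = nbr_mean g \<bar>snd v\<bar>"
proof -
  obtain x y where v: "v = (x, y)" by force
  have "measure_pmf.expectation (pmf_of_set (neighbours comb2_adj v)) (\<lambda>w. g \<bar>snd w\<bar>)
      = (\<Sum>w\<in>neighbours comb2_adj v. g \<bar>snd w\<bar>) / card (neighbours comb2_adj v)"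
    by (rule integral_pmf_of_set[OF comb2_neighbours_nonempty comb2_neighbours_finite])
  also have "\<dots> = nbr_mean g \<bar>snd v\<bar>"
  proof (cases "y = 0")
    case True
    then show ?thesis
      using assms by (simp add: v comb2_neighbours_axis nbr_mean_def)
  next
    case False
    then consider "y > 0" "\<bar>y + 1\<bar> = \<bar>y\<bar> + 1" "\<bar>y - 1\<bar> = \<bar>y\<bar> - 1"
      | "y < 0" "\<bar>y + 1\<bar> = \<bar>y\<bar> - 1" "\<bar>y - 1\<bar> = \<bar>y\<bar> + 1" by linarith
    then show ?thesis
      by cases (simp_all add: v comb2_neighbours_off_axis nbr_mean_def)
  qed
  finally show ?thesis .
qed

text \<open>
  Among the walks that have stayed below \<open>h\<close> for \<open>m\<close> steps, the averaged wave is the probability of staying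
  below \<open>h\<close> for another \<open>j\<close> steps. Its expectation depends only on \<open>m + j\<close>, since one more step of the
  walk does the work of one averaging: if that step reaches \<open>h\<close>, the path is discarded, but the averaged
  wave vanishes there in any case.
\<close>

lemma comb_survival_expectation:
  assumes "h > 0"
  shows "measure_pmf.expectation (walk_past_pmf comb2_adj (x, 0) m)
      (\<lambda>l. of_bool (\<forall>v\<in>set l. \<bar>snd v\<bar> < int h) * (nbr_mean ^^ j) (wave h) \<bar>snd (hd l)\<bar>)
    = (nbr_mean ^^ (m + j)) (wave h) 0"
proof (induction m arbitrary: j)
  case 0
  then show ?case using assms by simp
next
  case (Suc m)
  define g where "g = (nbr_mean ^^ j) (wave h)"
  have g: "g (int h) = 0" "g (- 1) = g 0"
    using nbr_mean_funpow_wave_zero[of j h] nbr_mean_funpow_wave_reflect[of j h 0]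
    by (simp_all add: g_def)
  have step: "measure_pmf.expectation (pmf_of_set (neighbours comb2_adj (hd l)))
      (\<lambda>w. of_bool (\<forall>v\<in>set (w # l). \<bar>snd v\<bar> < int h) * g \<bar>snd (hd (w # l))\<bar>)
    = of_bool (\<forall>v\<in>set l. \<bar>snd v\<bar> < int h) * nbr_mean g \<bar>snd (hd l)\<bar>" (is "?L = ?R")
    if "l \<in> set_pmf (walk_past_pmf comb2_adj (x, 0) m)" for l
  proof (cases "\<forall>v\<in>set l. \<bar>snd v\<bar> < int h")
    case True
    have "l \<noteq> []"
      using comb_walk_past_height_le[OF that] by simp
    then have hd: "\<bar>snd (hd l)\<bar> < int h"
      using True by simp
    have "?L = measure_pmf.expectation (pmf_of_set (neighbours comb2_adj (hd l))) (\<lambda>w. g \<bar>snd w\<bar>)"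
    proof (rule integral_cong_AE)
      show "AE w in pmf_of_set (neighbours comb2_adj (hd l)).
          of_bool (\<forall>v\<in>set (w # l). \<bar>snd v\<bar> < int h) * g \<bar>snd (hd (w # l))\<bar> = g \<bar>snd w\<bar>"
      proof (rule AE_pmfI)
        fix w assume "w \<in> set_pmf (pmf_of_set (neighbours comb2_adj (hd l)))"
        then have "\<bar>snd w\<bar> \<le> int h"
          using hd by (auto simp: comb_step_iff comb2_adj_def)
        then show "of_bool (\<forall>v\<in>set (w # l). \<bar>snd v\<bar> < int h) * g \<bar>snd (hd (w # l))\<bar> = g \<bar>snd w\<bar>"
          using True g(1) by (cases "\<bar>snd w\<bar> = int h") auto
      qed
    qed auto
    then show ?thesis
      using True expectation_comb_step_height[of g "hd l"] g(2) by simp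
  next
    case False
    then have "\<not> (\<forall>v\<in>set (w # l). \<bar>snd v\<bar> < int h)" for w
      by auto
    with False show ?thesis by (simp only: of_bool_eq) simp
  qed
  have "measure_pmf.expectation (walk_past_pmf comb2_adj (x, 0) (Suc m))
      (\<lambda>l. of_bool (\<forall>v\<in>set l. \<bar>snd v\<bar> < int h) * g \<bar>snd (hd l)\<bar>)
    = measure_pmf.expectation (walk_past_pmf comb2_adj (x, 0) m)
      (\<lambda>l. of_bool (\<forall>v\<in>set l. \<bar>snd v\<bar> < int h) * nbr_mean g \<bar>snd (hd l)\<bar>)"
    unfolding expectation_comb_walk_past_Suc
    by (intro integral_cong_AE AE_pmfI step) simp_all
  also have "\<dots> = (nbr_mean ^^ (m + Suc j)) (wave h) 0"
    using Suc.IH[of "Suc j"] by (simp add: g_def)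
  finally show ?case
    by (simp add: g_def)
qed

lemma prob_comb_height_less:
  assumes "h > 0"
  shows "measure_pmf.expectation (walk_past_pmf comb2_adj (x, 0) n)
      (\<lambda>l. of_bool (\<forall>v\<in>set l. \<bar>snd v\<bar> < int h)) = (nbr_mean ^^ n) (wave h) 0"
proof -
  have "measure_pmf.expectation (walk_past_pmf comb2_adj (x, 0) n)
      (\<lambda>l. of_bool (\<forall>v\<in>set l. \<bar>snd v\<bar> < int h))
    = measure_pmf.expectation (walk_past_pmf comb2_adj (x, 0) n)
      (\<lambda>l. of_bool (\<forall>v\<in>set l. \<bar>snd v\<bar> < int h) * (nbr_mean ^^ 0) (wave h) \<bar>snd (hd l)\<bar>)"
  proof (rule integral_cong_AE)
    show "AE l in walk_past_pmf comb2_adj (x, 0) n. of_bool (\<forall>v\<in>set l. \<bar>snd v\<bar> < int h)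
      = of_bool (\<forall>v\<in>set l. \<bar>snd v\<bar> < int h) * (nbr_mean ^^ 0) (wave h) \<bar>snd (hd l)\<bar>"
    proof (rule AE_pmfI)
      fix l assume "l \<in> set_pmf (walk_past_pmf comb2_adj (x, 0) n)"
      then have "hd l \<in> set l"
        using comb_walk_past_height_le[of l x n] by simp
      then show "of_bool (\<forall>v\<in>set l. \<bar>snd v\<bar> < int h)
        = of_bool (\<forall>v\<in>set l. \<bar>snd v\<bar> < int h) * (nbr_mean ^^ 0) (wave h) \<bar>snd (hd l)\<bar>"
        using wave_inside[of "\<bar>snd (hd l)\<bar>" h] by (cases "\<forall>v\<in>set l. \<bar>snd v\<bar> < int h") auto
    qed
  qed auto
  then show ?thesis
    using comb_survival_expectation[OF assms, of x n 0] by simp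
qed

lemma nat_eq_sum_thresholds:
  assumes "0 \<le> d" "d \<le> int n"
  shows "real_of_int d = (\<Sum>h=1..n. 1 - of_bool (d < int h))"
proof -
  have "(\<Sum>h=1..n. 1 - of_bool (d < int h) :: real) = (\<Sum>h=1..n. if h \<in> {1..nat d} then 1 else 0)"
    using assms by (intro sum.cong) (auto simp: le_nat_iff)
  also have "\<dots> = real (card ({1..n} \<inter> {1..nat d}))"
    by (subst sum.inter_restrict[symmetric]) auto
  also have "{1..n} \<inter> {1..nat d} = {1..nat d}"
    using assms by auto
  finally show ?thesis
    using assms by simp
qed

text \<open>
  The layer-cake formula: the maximum is the number of levels \<open>h \<ge> 1\<close> that have been reached, and none
  above \<open>n\<close> is reached in \<open>n\<close> steps.
\<close>

lemma expectation_max_height: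
  assumes walk: "simple_random_walk comb2_adj (x, 0) M S"
  shows "(\<integral>\<omega>. real_of_int (max_height S n \<omega>) \<partial>M)
    = (nbr_mean ^^ n) (\<lambda>y. \<Sum>h=1..n. 1 - wave h y) 0"
proof -
  define P where "P = walk_past_pmf comb2_adj (x, 0) n"
  define height where "height l = Max ((\<lambda>v. \<bar>snd v\<bar>) ` set l)" for l :: "(int \<times> int) list"
  have fin: "finite (set_pmf P)"
    by (simp add: P_def finite_comb_walk_past)
  have "(\<integral>\<omega>. real_of_int (max_height S n \<omega>) \<partial>M) = (\<integral>\<omega>. real_of_int (height (past S n \<omega>)) \<partial>M)"
    by (simp add: max_height_def height_def set_past image_image)
  also have "\<dots> = (\<integral>l. real_of_int (height l) \<partial>distr M (count_space UNIV) (past S n))"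
    by (rule integral_distr[OF distr_past_eq_walk_past_pmf(1)[OF walk], symmetric]) simp
  also have "\<dots> = measure_pmf.expectation P (\<lambda>l. real_of_int (height l))"
    unfolding P_def distr_past_eq_walk_past_pmf(2)[OF walk] ..
  also have "\<dots> = measure_pmf.expectation P
      (\<lambda>l. \<Sum>h=1..n. 1 - of_bool (\<forall>v\<in>set l. \<bar>snd v\<bar> < int h))"
  proof (rule integral_cong_AE)
    show "AE l in P. real_of_int (height l) = (\<Sum>h=1..n. 1 - of_bool (\<forall>v\<in>set l. \<bar>snd v\<bar> < int h))"
    proof (rule AE_pmfI)
      fix l assume "l \<in> set_pmf P"
      then have l: "l \<noteq> []" "\<And>v. v \<in> set l \<Longrightarrow> \<bar>snd v\<bar> \<le> int n"
        using comb_walk_past_height_le[of l x n] by (auto simp: P_def)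
      have "height l \<in> (\<lambda>v. \<bar>snd v\<bar>) ` set l"
        unfolding height_def using l(1) by (intro Max_in) auto
      then have "0 \<le> height l" "height l \<le> int n"
        using l(2) by auto
      moreover have "height l < int h \<longleftrightarrow> (\<forall>v\<in>set l. \<bar>snd v\<bar> < int h)" for h
        unfolding height_def using l(1) by (subst Max_less_iff) auto
      ultimately show "real_of_int (height l) = (\<Sum>h=1..n. 1 - of_bool (\<forall>v\<in>set l. \<bar>snd v\<bar> < int h))"
        using nat_eq_sum_thresholds[of "height l" n] by simp
    qed
  qed auto
  also have "\<dots> = (\<Sum>h=1..n. 1 - measure_pmf.expectation P (\<lambda>l. of_bool (\<forall>v\<in>set l. \<bar>snd v\<bar> < int h)))"
    by (simp add: Bochner_Integration.integral_sum Bochner_Integration.integral_diff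
        integrable_measure_pmf_finite[OF fin] measure_pmf.prob_space)
  also have "\<dots> = (\<Sum>h=1..n. 1 - (nbr_mean ^^ n) (wave h) 0)"
    unfolding P_def by (intro sum.cong refl) (subst prob_comb_height_less, auto)
  also have "\<dots> = (nbr_mean ^^ n) (\<lambda>y. \<Sum>h=1..n. 1 - wave h y) 0"
    by (simp add: nbr_mean_funpow_sum nbr_mean_funpow_diff nbr_mean_funpow_const)
  finally show ?thesis .
qed

section \<open>The expected maximal height\<close>

theorem theorem4p10:
  fixes M :: "'w measure" and S :: "nat \<Rightarrow> 'w \<Rightarrow> int \<times> int"
  assumes "simple_random_walk comb2_adj (0, 0) M S"
  shows "(\<lambda>n. \<integral>\<omega>. real_of_int (max_height S n \<omega>) \<partial>M)
           \<sim>[sequentially] (\<lambda>n. sqrt (pi / 2) * real n powr (1 / 2))"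
proof -
  define A where "A n = (nbr_mean ^^ n) (\<lambda>x. \<bar>2 * real_of_int x + 1\<bar>) 0" for n
  define E where "E n = (nbr_mean ^^ n) (\<lambda>y. \<Sum>h=1..n. 1 - wave h y) 0" for n
  have A_pos: "A n > 0" for n
  proof -
    have "1 \<le> \<bar>2 * real_of_int y + 1\<bar>" for y
    proof -
      have "real_of_int 1 \<le> real_of_int \<bar>2 * y + 1\<bar>"
        by (subst of_int_le_iff) presburger
      then show ?thesis by simp
    qed
    then have "(nbr_mean ^^ n) (\<lambda>_. 1) 0 \<le> A n"
      unfolding A_def by (intro nbr_mean_funpow_mono)
    then show ?thesis
      by (simp add: nbr_mean_funpow_const)
  qed
  have "(\<lambda>n. E n / A n * (A n / sqrt (real n))) \<longlonglongrightarrow> pi / 4 * sqrt (8 / pi)"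
    unfolding E_def A_def
    by (intro tendsto_mult expected_height_over_abs_mean abs_mean_asymp)
  moreover have "pi / 4 * sqrt (8 / pi) = sqrt (pi / 2)"
  proof -
    have "pi / 4 * sqrt (8 / pi) = sqrt ((pi / 4)\<^sup>2 * (8 / pi))"
      unfolding real_sqrt_mult real_sqrt_abs by simp
    also have "(pi / 4)\<^sup>2 * (8 / pi) = pi / 2"
      by (simp add: power2_eq_square)
    finally show ?thesis .
  qed
  ultimately have lim: "(\<lambda>n. E n / sqrt (real n)) \<longlonglongrightarrow> sqrt (pi / 2)"
    by (simp add: less_imp_neq[OF A_pos, symmetric])
  have "E \<sim>[sequentially] (\<lambda>n. sqrt (pi / 2) * real n powr (1 / 2))"
  proof (rule asymp_equivI')
    have "(\<lambda>n. E n / sqrt (real n) / sqrt (pi / 2)) \<longlonglongrightarrow> sqrt (pi / 2) / sqrt (pi / 2)"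
      by (intro tendsto_divide lim tendsto_const) simp
    moreover have "E n / sqrt (real n) / sqrt (pi / 2) = E n / (sqrt (pi / 2) * real n powr (1 / 2))" for n
      by (simp add: powr_half_sqrt mult.commute)
    moreover have "sqrt (pi / 2) / sqrt (pi / 2) = 1"
      by simp
    ultimately show "(\<lambda>n. E n / (sqrt (pi / 2) * real n powr (1 / 2))) \<longlonglongrightarrow> 1"
      by (simp only:)
  qed
  then show ?thesis
    unfolding E_def expectation_max_height[OF assms] .
qed

end
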